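(* Let $1\le p<q<\infty$ and $1\le r<\infty$. (i) If $r>1$, then $\ell^1(\mathbb Z)\subset\ell^p_{q,r}(\mathbb Z)\subset\ell^r(\mathbb Z)$ with continuous inclusions, and $\ell^1(\mathbb Z)\neq\ell^p_{q,r}(\mathbb Z)$. (ii) If $r>q$, then both inclusions are proper: $\ell^1(\mathbb Z)\subsetneq\ell^p_{q,r}(\mathbb Z)\subsetneq\ell^r(\mathbb Z)$. (iii) If $r=1$, then $\ell^p_{q,1}(\mathbb Z)=\ell^1(\mathbb Z)$.
   Context: For $j\in\mathbb N_0=\{0,1,2,\dots\}$ and $k\in\mathbb Z$ let $I(j,k)=[2^jk,2^j(k+1))\cap\mathbb Z$ (a discrete dyadic interval with $2^j$ elements). For $1\le p<q<\infty$, $1\le r<\infty$ and a real sequence $x=(x(k))_{k\in\mathbb Z}$ put $$\|x\|_{\ell^p_{q,r}}=\Big(\sum_{j=0}^\infty\sum_{k\in\mathbb Z}(2^j)^{r(\frac1q-\frac1p)}\Big(\sum_{l\in I(j,k)}|x(l)|^p\Big)^{r/p}\Big)^{1/r},$$ and let $\ell^p_{q,r}(\mathbb Z)$ be the space of all $x\in\mathbb R^{\mathbb Z}$ with $\|x\|_{\ell^p_{q,r}}<\infty$. Here $\ell^1(\mathbb Z),\ell^r(\mathbb Z)$ are the usual real sequence spaces. *)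

theory Defs
  imports "HOL-Analysis.Analysis"
begin

definition dyadic_interval :: "nat \<Rightarrow> int \<Rightarrow> int set" where
  "dyadic_interval j k = {2 ^ j * k ..< 2 ^ j * (k + 1)}"

text \<open>
  The sums inside the norms have nonnegative terms and may diverge, so they are taken
  in \<^typ>\<open>ennreal\<close>. A space consists of the sequences with finite sum (equivalently,
  finite norm); the real-valued norm is meaningful on the space only.
\<close>

definition lp_sum :: "real \<Rightarrow> (int \<Rightarrow> real) \<Rightarrow> ennreal" where
  "lp_sum s x = (\<Sum>\<^sub>\<infinity>k. ennreal (\<bar>x k\<bar> powr s))"

definition lp_space :: "real \<Rightarrow> (int \<Rightarrow> real) set" where
  "lp_space s = {x. lp_sum s x < \<infinity>}"

definition lp_norm :: "real \<Rightarrow> (int \<Rightarrow> real) \<Rightarrow> real" where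
  "lp_norm s x = enn2real (lp_sum s x) powr (1 / s)"

definition lpqr_sum :: "real \<Rightarrow> real \<Rightarrow> real \<Rightarrow> (int \<Rightarrow> real) \<Rightarrow> ennreal" where
  "lpqr_sum p q r x =
     (\<Sum>\<^sub>\<infinity>j. \<Sum>\<^sub>\<infinity>k. ennreal ((2 ^ j) powr (r * (1 / q - 1 / p))
        * (\<Sum>l\<in>dyadic_interval j k. \<bar>x l\<bar> powr p) powr (r / p)))"

definition lpqr_space :: "real \<Rightarrow> real \<Rightarrow> real \<Rightarrow> (int \<Rightarrow> real) set" where
  "lpqr_space p q r = {x. lpqr_sum p q r x < \<infinity>}"

definition lpqr_norm :: "real \<Rightarrow> real \<Rightarrow> real \<Rightarrow> (int \<Rightarrow> real) \<Rightarrow> real" where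
  "lpqr_norm p q r x = enn2real (lpqr_sum p q r x) powr (1 / r)"

text \<open>
  The induced distance is a metric on the space only if \<open>N\<close> is a norm there, which for the norms
  above is the Minkowski inequality and needs all the exponents \<open>s\<close>, \<open>p\<close>, \<open>r\<close> to be at least 1.
\<close>

definition norm_topology :: "(int \<Rightarrow> real) set \<Rightarrow> ((int \<Rightarrow> real) \<Rightarrow> real) \<Rightarrow> (int \<Rightarrow> real) topology" where
  "norm_topology V N = Metric_space.mtopology V (\<lambda>x y. N (\<lambda>k. x k - y k))"

abbreviation lp_topology :: "real \<Rightarrow> (int \<Rightarrow> real) topology" where
  "lp_topology s \<equiv> norm_topology (lp_space s) (lp_norm s)"

abbreviation lpqr_topology :: "real \<Rightarrow> real \<Rightarrow> real \<Rightarrow> (int \<Rightarrow> real) topology" where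
  "lpqr_topology p q r \<equiv> norm_topology (lpqr_space p q r) (lpqr_norm p q r)"

end

theory Submission
  imports Defs
begin

text \<open>
  Write \<open>\<epsilon> = 1 / p - 1 / q > 0\<close>, so that level \<open>j\<close> carries the weight \<open>2 powr (- j * r * \<epsilon>)\<close>.
  For \<open>x\<close> in \<open>\<ell>\<^sup>1\<close> the \<open>\<ell>\<^sup>p\<close>-norm of a block is at most its \<open>\<ell>\<^sup>1\<close>-norm, and the \<open>r\<close>-th
  powers of the \<open>\<ell>\<^sup>1\<close>-norms of disjoint blocks add up to at most the \<open>r\<close>-th power of the
  full \<open>\<ell>\<^sup>1\<close>-norm. Every level is thus bounded by the same quantity times its weight, the weights
  form a geometric series, and \<open>\<ell>\<^sup>1 \<subseteq> \<ell>\<^sup>p\<^sub>q\<^sub>,\<^sub>r\<close> follows with a norm bound (\<open>lpqr_norm_le_lp_norm\<close>).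
  Conversely the blocks of level 0 are single entries of weight 1, so the sum defining the
  \<open>\<ell>\<^sup>r\<close>-norm is a part of the sum defining the \<open>\<ell>\<^sup>p\<^sub>q\<^sub>,\<^sub>r\<close>-norm (\<open>lp_sum_le_lpqr_sum\<close>). For
  \<open>r = 1\<close> the two inclusions give equality.
  
  The norm bounds yield continuity once the norms are known to define metrics. Each norm is the
  root of a convex functional that is homogeneous of the same degree, and every such root
  satisfies the triangle inequality because its unit ball is convex (the locale
  \<open>convex_modular\<close>).
  
  Properness is shown by sequences \<open>k powr - s\<close> on \<open>k \<ge> 1\<close>. The sequence \<open>1 / k\<close> is not in \<open>\<ell>\<^sup>1\<close>, but
  in \<open>\<ell>\<^sup>p\<^sub>q\<^sub>,\<^sub>r\<close> for \<open>r > 1\<close> (\<open>reciprocal_mem_lpqr_space\<close>). The sequence \<open>k powr - (1 / q)\<close> is in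
  \<open>\<ell>\<^sup>r\<close> for \<open>r > q\<close>, but not in \<open>\<ell>\<^sup>p\<^sub>q\<^sub>,\<^sub>r\<close>, because its block \<open>[2^j, 2^(j+1))\<close> contributes at
  least a fixed positive amount on every level (\<open>critical_power_notin_lpqr_space\<close>).
\<close>

section \<open>Infinite sums of nonnegative terms\<close>

lemma infsum_mono_ennreal:
  fixes f g :: "'a \<Rightarrow> ennreal"
  assumes "\<And>i. f i \<le> g i"
  shows "infsum f A \<le> infsum g A"
  using assms by (intro infsum_mono nonneg_summable_on_complete) auto

text \<open>
  Multiplication on \<^typ>\<open>ennreal\<close> is not continuous at \<open>(0, \<infinity>)\<close>, so the constant is pulled through
  the supremum of the finite partial sums instead of through a limit.
\<close>

lemma infsum_cmult_ennreal:
  fixes f :: "'a \<Rightarrow> ennreal"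
  shows "(\<Sum>\<^sub>\<infinity>i\<in>A. c * f i) = c * (\<Sum>\<^sub>\<infinity>i\<in>A. f i)"
  by (simp add: nonneg_infsum_complete SUP_mult_left_ennreal sum_distrib_left)

lemma term_le_infsum_ennreal:
  fixes f :: "'a \<Rightarrow> ennreal"
  assumes "i \<in> A"
  shows "f i \<le> infsum f A"
proof -
  have "sum f {i} \<le> infsum f A"
    using assms by (subst nonneg_infsum_complete, simp, intro SUP_upper) auto
  thus ?thesis by simp
qed

lemma infsum_ennreal_of_summable_on:
  fixes f :: "'a \<Rightarrow> real"
  assumes "f summable_on A" and "\<And>i. 0 \<le> f i"
  shows "(\<Sum>\<^sub>\<infinity>i\<in>A. ennreal (f i)) = ennreal (infsum f A)"
  using assms by (simp add: infsum_nonneg_is_SUPREMUM_ennreal nonneg_infsum_complete sum_ennreal)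

lemma infsum_ennreal_finite_iff:
  fixes f :: "'a \<Rightarrow> real"
  assumes "\<And>i. 0 \<le> f i"
  shows "(\<Sum>\<^sub>\<infinity>i\<in>A. ennreal (f i)) < \<infinity> \<longleftrightarrow> f summable_on A"
proof
  assume fin: "(\<Sum>\<^sub>\<infinity>i\<in>A. ennreal (f i)) < \<infinity>"
  show "f summable_on A"
  proof (rule nonneg_bdd_above_summable_on)
    show "bdd_above (sum f ` {F. F \<subseteq> A \<and> finite F})"
    proof (intro bdd_aboveI2, clarify)
      fix F assume F: "F \<subseteq> A" "finite F"
      have "ennreal (sum f F) = (\<Sum>i\<in>F. ennreal (f i))"
        using assms by (simp add: sum_ennreal)
      also have "\<dots> \<le> (\<Sum>\<^sub>\<infinity>i\<in>A. ennreal (f i))"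
        using F by (subst nonneg_infsum_complete, simp, intro SUP_upper) auto
      finally show "sum f F \<le> enn2real (\<Sum>\<^sub>\<infinity>i\<in>A. ennreal (f i))"
        by (metis assms enn2real_ennreal enn2real_mono fin infinity_ennreal_def sum_nonneg)
    qed
  qed (use assms in auto)
next
  assume "f summable_on A"
  thus "(\<Sum>\<^sub>\<infinity>i\<in>A. ennreal (f i)) < \<infinity>"
    using assms by (simp add: infsum_ennreal_of_summable_on)
qed

section \<open>Two power inequalities\<close>

lemma powr_convex_combination:
  fixes a b u v s :: real
  assumes "1 \<le> s" "0 \<le> a" "0 \<le> b" "0 < u" "0 < v" "u + v = 1"
  shows "(u * a + v * b) powr s \<le> u * a powr s + v * b powr s"
proof -
  have shrink: "c powr s \<le> c" if "0 < c" "c \<le> 1" for c :: real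
    using powr_mono'[of 1 s c] that assms(1) by simp
  consider "a = 0" | "b = 0" | "0 < a" "0 < b" using assms by linarith
  thus ?thesis
  proof cases
    case 1
    thus ?thesis using shrink[of v] assms
      by (simp add: powr_mult mult_right_mono)
  next
    case 2
    thus ?thesis using shrink[of u] assms
      by (simp add: powr_mult mult_right_mono)
  next
    case 3
    have "u = 1 - v" using assms by simp
    thus ?thesis
      using convex_onD[OF powr_convex[OF assms(1)], of v a b] 3 \<open>0 < u\<close> \<open>0 < v\<close> by simp
  qed
qed

text \<open>
  This is the inclusion of \<open>\<ell>\<^sup>1\<close> in \<open>\<ell>\<^sup>s\<close>. Each entry is at most the total \<open>S\<close>, so
  \<open>t powr s = t * t powr (s - 1) \<le> t * S powr (s - 1)\<close>, and these bounds add up to \<open>S powr s\<close>.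
\<close>

lemma sum_powr_le_powr_sum:
  fixes f :: "'a \<Rightarrow> real"
  assumes "1 \<le> s" and "finite A" and "\<And>i. i \<in> A \<Longrightarrow> 0 \<le> f i"
  shows "(\<Sum>i\<in>A. f i powr s) \<le> (\<Sum>i\<in>A. f i) powr s"
proof -
  have split: "t powr s = t * t powr (s - 1)" if "0 \<le> t" for t :: real
    using that powr_mult_base[of t "s - 1"] by simp
  have "(\<Sum>i\<in>A. f i powr s) \<le> (\<Sum>i\<in>A. f i * sum f A powr (s - 1))"
  proof (rule sum_mono)
    fix i assume i: "i \<in> A"
    have "f i \<le> sum f A" using i assms by (intro member_le_sum) auto
    thus "f i powr s \<le> f i * sum f A powr (s - 1)"
      using assms i by (auto simp: split intro!: mult_left_mono powr_mono2)
  qed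
  also have "\<dots> = sum f A powr s"
    using assms by (simp add: split sum_nonneg flip: sum_distrib_right)
  finally show ?thesis .
qed

section \<open>Norms from convex homogeneous functionals\<close>

text \<open>
  The sums that define the two kinds of norm share three properties: values in \<open>[0, \<infinity>]\<close>,
  homogeneity of degree \<open>s\<close>, and convexity. These already give the Minkowski inequality for
  the \<open>s\<close>-th root, so it is proved once here and used for blocks of entries, for \<open>\<ell>\<^sup>s\<close>
  and for \<open>\<ell>\<^sup>p\<^sub>q\<^sub>,\<^sub>r\<close>.
\<close>

locale convex_modular =
  fixes F :: "('a \<Rightarrow> real) \<Rightarrow> ennreal" and s :: real
  assumes exponent: "1 \<le> s"
    and scale: "F (\<lambda>k. c * x k) = ennreal (\<bar>c\<bar> powr s) * F x"
    and convex: "\<lbrakk>0 < u; 0 < v; u + v = 1\<rbrakk> \<Longrightarrow>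
      F (\<lambda>k. u * x k + v * y k) \<le> ennreal u * F x + ennreal v * F y"
begin

definition modular_norm :: "('a \<Rightarrow> real) \<Rightarrow> real" where
  "modular_norm x = enn2real (F x) powr (1 / s)"

lemma modular_norm_nonneg: "0 \<le> modular_norm x"
  by (simp add: modular_norm_def)

lemma modular_norm_scale: "modular_norm (\<lambda>k. c * x k) = \<bar>c\<bar> * modular_norm x"
  using exponent by (simp add: modular_norm_def scale enn2real_mult powr_mult powr_powr)

lemma le_powr_if_modular_norm_le:
  assumes "F x < \<infinity>" and "modular_norm x \<le> a"
  shows "F x \<le> ennreal (a powr s)"
proof -
  have "enn2real (F x) = modular_norm x powr s"
    using exponent by (simp add: modular_norm_def powr_powr)
  also have "\<dots> \<le> a powr s"
    using exponent assms modular_norm_nonneg by (intro powr_mono2) auto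
  finally show ?thesis
    using assms(1) by (metis ennreal_enn2real ennreal_leI infinity_ennreal_def)
qed

text \<open>
  The set where \<open>F \<le> 1\<close> is convex. It contains \<open>x / a\<close> and \<open>y / b\<close>, hence also their convex
  combination \<open>(x + y) / (a + b)\<close> with weights \<open>a / (a + b)\<close> and \<open>b / (a + b)\<close>.
\<close>

lemma add_le_powr:
  assumes "0 < a" "0 < b" and x: "F x \<le> ennreal (a powr s)" and y: "F y \<le> ennreal (b powr s)"
  shows "F (\<lambda>k. x k + y k) \<le> ennreal ((a + b) powr s)"
proof -
  define u v where "u = a / (a + b)" and "v = b / (a + b)"
  have uv: "0 < u" "0 < v" "u + v = 1"
    using assms by (auto simp: u_def v_def add_divide_distrib[symmetric])
  have unit: "F (\<lambda>k. 1 / c * z k) \<le> 1" if "0 < c" "F z \<le> ennreal (c powr s)" for c z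
  proof -
    have "F (\<lambda>k. 1 / c * z k) \<le> ennreal (\<bar>1 / c\<bar> powr s) * ennreal (c powr s)"
      unfolding scale by (intro mult_left_mono that) simp
    also have "\<dots> = 1"
      using that by (simp add: ennreal_mult[symmetric] powr_divide)
    finally show ?thesis .
  qed
  have "(\<lambda>k. x k + y k) = (\<lambda>k. (a + b) * (u * (1 / a * x k) + v * (1 / b * y k)))"
  proof
    fix k
    have "(a + b) * u = a" "(a + b) * v = b"
      using assms by (auto simp: u_def v_def)
    thus "x k + y k = (a + b) * (u * (1 / a * x k) + v * (1 / b * y k))"
      using assms by (simp add: distrib_left flip: mult.assoc)
  qed
  hence "F (\<lambda>k. x k + y k)
      = ennreal ((a + b) powr s) * F (\<lambda>k. u * (1 / a * x k) + v * (1 / b * y k))"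
    using assms by (simp add: scale)
  also have "F (\<lambda>k. u * (1 / a * x k) + v * (1 / b * y k)) \<le> ennreal u * 1 + ennreal v * 1"
    by (rule order_trans[OF convex[OF uv]], intro add_mono mult_left_mono unit) (use assms in auto)
  also have "\<dots> = 1"
    using uv by (simp add: ennreal_plus[symmetric] del: ennreal_plus)
  finally show ?thesis by (simp add: mult_left_mono)
qed

lemma add_finite:
  assumes "F x < \<infinity>" "F y < \<infinity>"
  shows "F (\<lambda>k. x k + y k) < \<infinity>"
proof -
  have "F z \<le> ennreal ((modular_norm z + 1) powr s)" if "F z < \<infinity>" for z
    using le_powr_if_modular_norm_le[OF that] by simp
  hence "F (\<lambda>k. x k + y k) \<le> ennreal ((modular_norm x + 1 + (modular_norm y + 1)) powr s)"
    using assms modular_norm_nonneg by (intro add_le_powr) (auto simp: add_nonneg_pos)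
  thus ?thesis by (simp add: le_less_trans)
qed

lemma modular_norm_add:
  assumes "F x < \<infinity>" "F y < \<infinity>"
  shows "modular_norm (\<lambda>k. x k + y k) \<le> modular_norm x + modular_norm y"
proof (rule field_le_epsilon)
  fix e :: real assume "0 < e"
  \<comment> \<open>The radii are enlarged because a norm may vanish, and the rescaling divides by the radius.\<close>
  define a b where "a = modular_norm x + e / 2" and "b = modular_norm y + e / 2"
  have ab: "0 < a" "0 < b" "a + b = modular_norm x + modular_norm y + e"
    using \<open>0 < e\<close> modular_norm_nonneg by (auto simp: a_def b_def add_nonneg_pos)
  have "F (\<lambda>k. x k + y k) \<le> ennreal ((a + b) powr s)"
    using \<open>0 < e\<close> by (intro add_le_powr ab le_powr_if_modular_norm_le assms) (auto simp: a_def b_def)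
  hence "enn2real (F (\<lambda>k. x k + y k)) \<le> (a + b) powr s"
    by (simp add: enn2real_leI)
  hence "modular_norm (\<lambda>k. x k + y k) \<le> ((a + b) powr s) powr (1 / s)"
    unfolding modular_norm_def using exponent by (intro powr_mono2) auto
  thus "modular_norm (\<lambda>k. x k + y k) \<le> modular_norm x + modular_norm y + e"
    using ab exponent by (simp add: powr_powr)
qed

lemma diff_finite:
  assumes "F x < \<infinity>" "F y < \<infinity>"
  shows "F (\<lambda>k. x k - y k) < \<infinity>"
  using add_finite[of x "\<lambda>k. - 1 * y k"] assms scale[of "-1" y] by simp

text \<open>
  Besides the triangle inequality, homogeneity with the factors \<open>-1\<close> and \<open>0\<close> gives symmetry and
  the vanishing on the diagonal. Only definiteness does not follow from convexity and homogeneity: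
  a sum over a proper subset of the indices violates it.
\<close>

lemma Metric_space_modular_norm:
  assumes definite: "\<And>x. F x = 0 \<Longrightarrow> x = (\<lambda>k. 0)"
  shows "Metric_space {x. F x < \<infinity>} (\<lambda>x y. modular_norm (\<lambda>k. x k - y k))"
proof
  fix x y z :: "'a \<Rightarrow> real"
  show "0 \<le> modular_norm (\<lambda>k. x k - y k)" by (rule modular_norm_nonneg)
  show "modular_norm (\<lambda>k. x k - y k) = modular_norm (\<lambda>k. y k - x k)"
    using modular_norm_scale[of "-1" "\<lambda>k. y k - x k"] by simp
  assume x: "x \<in> {x. F x < \<infinity>}" and y: "y \<in> {x. F x < \<infinity>}"
  show "modular_norm (\<lambda>k. x k - y k) = 0 \<longleftrightarrow> x = y"
  proof
    assume "modular_norm (\<lambda>k. x k - y k) = 0"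
    hence "F (\<lambda>k. x k - y k) = 0"
      using diff_finite[of x y] x y by (auto simp: modular_norm_def enn2real_eq_0_iff)
    from definite[OF this] show "x = y" by (auto simp: fun_eq_iff)
  next
    assume "x = y"
    thus "modular_norm (\<lambda>k. x k - y k) = 0" using modular_norm_scale[of 0 x] by simp
  qed
  assume z: "z \<in> {x. F x < \<infinity>}"
  show "modular_norm (\<lambda>k. x k - z k) \<le> modular_norm (\<lambda>k. x k - y k) + modular_norm (\<lambda>k. y k - z k)"
    using modular_norm_add[OF diff_finite diff_finite, of x y y z] x y z by simp
qed

end

text \<open>
  The index set is arbitrary so that the finite blocks and the whole of \<open>\<int>\<close> are both instances.
\<close>

lemma convex_modular_infsum_powr:
  assumes "1 \<le> s"
  shows "convex_modular (\<lambda>x. \<Sum>\<^sub>\<infinity>k\<in>A. ennreal (\<bar>x k\<bar> powr s)) s"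
proof
  show "1 \<le> s" by fact
next
  fix c :: real and x :: "'a \<Rightarrow> real"
  show "(\<Sum>\<^sub>\<infinity>k\<in>A. ennreal (\<bar>c * x k\<bar> powr s))
      = ennreal (\<bar>c\<bar> powr s) * (\<Sum>\<^sub>\<infinity>k\<in>A. ennreal (\<bar>x k\<bar> powr s))"
    by (simp add: abs_mult powr_mult ennreal_mult infsum_cmult_ennreal)
next
  fix u v :: real and x y :: "'a \<Rightarrow> real"
  assume uv: "0 < u" "0 < v" "u + v = 1"
  have "\<bar>u * x k + v * y k\<bar> powr s \<le> u * \<bar>x k\<bar> powr s + v * \<bar>y k\<bar> powr s" for k
  proof -
    have "\<bar>u * x k + v * y k\<bar> \<le> u * \<bar>x k\<bar> + v * \<bar>y k\<bar>"
      using uv abs_triangle_ineq[of "u * x k" "v * y k"] by (simp add: abs_mult)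
    hence "\<bar>u * x k + v * y k\<bar> powr s \<le> (u * \<bar>x k\<bar> + v * \<bar>y k\<bar>) powr s"
      using assms by (intro powr_mono2) auto
    also have "\<dots> \<le> u * \<bar>x k\<bar> powr s + v * \<bar>y k\<bar> powr s"
      using assms uv by (intro powr_convex_combination) auto
    finally show ?thesis .
  qed
  hence "ennreal (\<bar>u * x k + v * y k\<bar> powr s)
      \<le> ennreal u * ennreal (\<bar>x k\<bar> powr s) + ennreal v * ennreal (\<bar>y k\<bar> powr s)" for k
    using uv by (simp add: ennreal_mult[symmetric] ennreal_plus[symmetric] ennreal_leI
        del: ennreal_plus)
  hence "(\<Sum>\<^sub>\<infinity>k\<in>A. ennreal (\<bar>u * x k + v * y k\<bar> powr s))
      \<le> (\<Sum>\<^sub>\<infinity>k\<in>A. ennreal u * ennreal (\<bar>x k\<bar> powr s) + ennreal v * ennreal (\<bar>y k\<bar> powr s))"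
    by (rule infsum_mono_ennreal)
  thus "(\<Sum>\<^sub>\<infinity>k\<in>A. ennreal (\<bar>u * x k + v * y k\<bar> powr s))
      \<le> ennreal u * (\<Sum>\<^sub>\<infinity>k\<in>A. ennreal (\<bar>x k\<bar> powr s))
        + ennreal v * (\<Sum>\<^sub>\<infinity>k\<in>A. ennreal (\<bar>y k\<bar> powr s))"
    by (simp add: infsum_add nonneg_summable_on_complete infsum_cmult_ennreal)
qed

lemma Minkowski_sum:
  fixes x y :: "'a \<Rightarrow> real"
  assumes "1 \<le> p" and "finite A"
  shows "(\<Sum>k\<in>A. \<bar>x k + y k\<bar> powr p) powr (1 / p)
    \<le> (\<Sum>k\<in>A. \<bar>x k\<bar> powr p) powr (1 / p) + (\<Sum>k\<in>A. \<bar>y k\<bar> powr p) powr (1 / p)"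
proof -
  interpret convex_modular "\<lambda>x. \<Sum>\<^sub>\<infinity>k\<in>A. ennreal (\<bar>x k\<bar> powr p)" p
    using assms(1) by (rule convex_modular_infsum_powr)
  have F: "(\<Sum>\<^sub>\<infinity>k\<in>A. ennreal (\<bar>z k\<bar> powr p)) = ennreal (\<Sum>k\<in>A. \<bar>z k\<bar> powr p)" for z
    using assms(2) by (simp add: sum_ennreal)
  have "modular_norm z = (\<Sum>k\<in>A. \<bar>z k\<bar> powr p) powr (1 / p)" for z
    unfolding modular_norm_def unfolding F by (simp add: sum_nonneg)
  thus ?thesis using modular_norm_add[of x y] by (simp add: F)
qed

section \<open>The spaces and their norms\<close>

text \<open>
  A bound between the norms makes the inclusion Lipschitz. The bound is asked for on differences
  of members of \<open>V\<close> and not for all sequences, because the real-valued norms give the value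
  0 to a sequence whose sum diverges, and the bound may then fail.
\<close>

lemma continuous_map_norm_topology:
  assumes "Metric_space V (\<lambda>x y. N (\<lambda>k. x k - y k))" "Metric_space W (\<lambda>x y. L (\<lambda>k. x k - y k))"
    and "V \<subseteq> W"
    and le: "\<And>x y. \<lbrakk>x \<in> V; y \<in> V\<rbrakk> \<Longrightarrow> L (\<lambda>k. x k - y k) \<le> C * N (\<lambda>k. x k - y k)"
  shows "continuous_map (norm_topology V N) (norm_topology W L) (\<lambda>x. x)"
proof -
  let ?m = "metric (V, \<lambda>x y. N (\<lambda>k. x k - y k))" and ?m' = "metric (W, \<lambda>x y. L (\<lambda>k. x k - y k))"
  have "Lipschitz_continuous_map ?m ?m' (\<lambda>x. x)"
    unfolding Lipschitz_continuous_map_def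
    using assms by (auto simp: Metric_space.mspace_metric Metric_space.mdist_metric intro!: exI[of _ C])
  from Lipschitz_continuous_imp_continuous_map[OF this]
  show ?thesis
    by (simp add: norm_topology_def mtopology_of_def Metric_space.mspace_metric
        Metric_space.mdist_metric assms)
qed

text \<open>
  In this form disjointness of the intervals of one level is immediate.
\<close>

lemma mem_dyadic_interval_iff: "l \<in> dyadic_interval j k \<longleftrightarrow> l div 2 ^ j = k"
proof -
  have "2 ^ j * k \<le> l \<and> l < 2 ^ j * (k + 1) \<Longrightarrow> l div 2 ^ j = k"
    by (rule int_div_pos_eq[of _ _ _ "l - 2 ^ j * k"]) (auto simp: algebra_simps)
  moreover have "2 ^ j * (l div 2 ^ j) \<le> l" "l < 2 ^ j * (l div 2 ^ j + 1)"
    using mult_div_mod_eq[of "2 ^ j" l] pos_mod_bound[of "2 ^ j" l] pos_mod_sign[of "2 ^ j" l] zero_less_power[of "2::int" j]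
    unfolding distrib_left mult_1_right by linarith+
  ultimately show ?thesis
    unfolding dyadic_interval_def by auto
qed

lemma dyadic_interval_0: "dyadic_interval 0 k = {k}"
  by (auto simp: dyadic_interval_def)

lemma finite_dyadic_interval: "finite (dyadic_interval j k)"
  by (simp add: dyadic_interval_def)

lemma card_dyadic_interval: "card (dyadic_interval j k) = 2 ^ j"
  by (simp add: dyadic_interval_def algebra_simps nat_power_eq)

text \<open>
  Every term is a weight times the \<open>r\<close>-th power of the \<open>\<ell>\<^sup>p\<close>-norm of a block. The \<open>\<ell>\<^sup>p\<close>-norm
  satisfies the triangle inequality, which makes convexity visible also when \<open>r < p\<close>.
\<close>

lemma lpqr_sum_eq_block_norms:
  assumes "1 \<le> p"
  shows "lpqr_sum p q r x = (\<Sum>\<^sub>\<infinity>j. \<Sum>\<^sub>\<infinity>k. ennreal ((2 ^ j) powr (r * (1 / q - 1 / p))) *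
    ennreal (((\<Sum>l\<in>dyadic_interval j k. \<bar>x l\<bar> powr p) powr (1 / p)) powr r))"
  using assms by (simp add: lpqr_sum_def powr_powr ennreal_mult)

lemma convex_modular_lp_sum: "1 \<le> s \<Longrightarrow> convex_modular (lp_sum s) s"
  using convex_modular_infsum_powr[of s UNIV] by (simp add: lp_sum_def[abs_def])

lemma lp_sum_definite: "lp_sum s x = 0 \<Longrightarrow> x = (\<lambda>k. 0)"
proof
  fix k assume "lp_sum s x = 0"
  hence "ennreal (\<bar>x k\<bar> powr s) \<le> 0"
    using term_le_infsum_ennreal[of k UNIV "\<lambda>k. ennreal (\<bar>x k\<bar> powr s)"] by (simp add: lp_sum_def)
  thus "x k = 0" by simp
qed

text \<open>
  The intervals of level 0 are singletons of weight 1, so level 0 alone contributes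
  the whole of \<open>lp_sum r x\<close>.
\<close>

lemma lp_sum_le_lpqr_sum:
  assumes "1 \<le> p"
  shows "lp_sum r x \<le> lpqr_sum p q r x"
proof -
  have "lp_sum r x = (\<Sum>\<^sub>\<infinity>k. ennreal ((2 ^ 0) powr (r * (1 / q - 1 / p))
        * (\<Sum>l\<in>dyadic_interval 0 k. \<bar>x l\<bar> powr p) powr (r / p)))"
    using assms by (simp add: lp_sum_def dyadic_interval_0 powr_powr)
  also have "\<dots> \<le> lpqr_sum p q r x"
    unfolding lpqr_sum_def by (rule term_le_infsum_ennreal) simp
  finally show ?thesis .
qed

text \<open>
  Convexity holds term by term: the block norm is convex by the Minkowski inequality with
  exponent \<open>p\<close>, and \<open>t powr r\<close> is increasing and convex.
\<close>

lemma convex_modular_lpqr_sum: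
  assumes "1 \<le> p" "1 \<le> r"
  shows "convex_modular (lpqr_sum p q r) r"
proof
  show "1 \<le> r" by fact
next
  fix c :: real and x :: "int \<Rightarrow> real"
  have "((\<Sum>l\<in>I. \<bar>c * x l\<bar> powr p) powr (1 / p)) powr r
      = \<bar>c\<bar> powr r * ((\<Sum>l\<in>I. \<bar>x l\<bar> powr p) powr (1 / p)) powr r" for I :: "int set"
    using assms by (simp add: abs_mult powr_mult powr_powr sum_nonneg flip: sum_distrib_left)
  hence "ennreal w * ennreal (((\<Sum>l\<in>I. \<bar>c * x l\<bar> powr p) powr (1 / p)) powr r)
      = ennreal (\<bar>c\<bar> powr r)
        * (ennreal w * ennreal (((\<Sum>l\<in>I. \<bar>x l\<bar> powr p) powr (1 / p)) powr r))" for w and I :: "int set"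
    by (simp add: ennreal_mult mult.left_commute)
  thus "lpqr_sum p q r (\<lambda>k. c * x k) = ennreal (\<bar>c\<bar> powr r) * lpqr_sum p q r x"
    unfolding lpqr_sum_eq_block_norms[OF assms(1)] by (simp only: infsum_cmult_ennreal)
next
  fix u v :: real and x y :: "int \<Rightarrow> real"
  assume uv: "0 < u" "0 < v" "u + v = 1"
  define w where "w j = ennreal ((2 ^ j) powr (r * (1 / q - 1 / p)))" for j :: nat
  define N where "N z I = (\<Sum>l\<in>I. \<bar>z l\<bar> powr p) powr (1 / p)" for z :: "int \<Rightarrow> real" and I
  have sum_eq: "lpqr_sum p q r z
      = (\<Sum>\<^sub>\<infinity>j. \<Sum>\<^sub>\<infinity>k. w j * ennreal (N z (dyadic_interval j k) powr r))" for z
    using assms(1) by (simp add: lpqr_sum_eq_block_norms w_def N_def)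
  have N_scale: "N (\<lambda>k. c * z k) I = c * N z I" if "0 < c" for c z I
    using assms that
    by (simp add: N_def abs_mult powr_mult powr_powr sum_nonneg flip: sum_distrib_left)
  have "N (\<lambda>k. u * x k + v * y k) I powr r \<le> u * N x I powr r + v * N y I powr r"
    if "finite I" for I
  proof -
    have "N (\<lambda>k. u * x k + v * y k) I \<le> u * N x I + v * N y I"
      using Minkowski_sum[OF assms(1) that, of "\<lambda>k. u * x k" "\<lambda>k. v * y k"] uv
      by (simp add: N_def[symmetric] N_scale)
    hence "N (\<lambda>k. u * x k + v * y k) I powr r \<le> (u * N x I + v * N y I) powr r"
      using assms by (intro powr_mono2) (auto simp: N_def)
    also have "\<dots> \<le> u * N x I powr r + v * N y I powr r"
      using assms uv by (intro powr_convex_combination) (auto simp: N_def)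
    finally show ?thesis .
  qed
  hence conv: "ennreal (N (\<lambda>k. u * x k + v * y k) (dyadic_interval j k) powr r)
      \<le> ennreal (u * N x (dyadic_interval j k) powr r + v * N y (dyadic_interval j k) powr r)" for j k
    using finite_dyadic_interval by (metis ennreal_leI)
  have "w j * ennreal (N (\<lambda>k. u * x k + v * y k) (dyadic_interval j k) powr r)
      \<le> ennreal u * (w j * ennreal (N x (dyadic_interval j k) powr r))
        + ennreal v * (w j * ennreal (N y (dyadic_interval j k) powr r))" for j k
  proof -
    have "w j * ennreal (N (\<lambda>k. u * x k + v * y k) (dyadic_interval j k) powr r)
        \<le> w j * (ennreal u * ennreal (N x (dyadic_interval j k) powr r)
          + ennreal v * ennreal (N y (dyadic_interval j k) powr r))"
      using uv conv[of j k] by (intro mult_left_mono) (simp_all add: ennreal_mult ennreal_plus)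
    thus ?thesis by (simp only: distrib_left mult.left_commute)
  qed
  hence "lpqr_sum p q r (\<lambda>k. u * x k + v * y k)
      \<le> (\<Sum>\<^sub>\<infinity>j. \<Sum>\<^sub>\<infinity>k. ennreal u * (w j * ennreal (N x (dyadic_interval j k) powr r))
        + ennreal v * (w j * ennreal (N y (dyadic_interval j k) powr r)))"
    unfolding sum_eq by (intro infsum_mono_ennreal)
  also have "\<dots> = ennreal u * lpqr_sum p q r x + ennreal v * lpqr_sum p q r y"
    unfolding sum_eq by (simp add: infsum_add nonneg_summable_on_complete infsum_cmult_ennreal)
  finally show "lpqr_sum p q r (\<lambda>k. u * x k + v * y k)
      \<le> ennreal u * lpqr_sum p q r x + ennreal v * lpqr_sum p q r y" .
qed

lemma Metric_space_lp:
  assumes "1 \<le> s"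
  shows "Metric_space (lp_space s) (\<lambda>x y. lp_norm s (\<lambda>k. x k - y k))"
proof -
  interpret convex_modular "lp_sum s" s using assms by (rule convex_modular_lp_sum)
  show ?thesis
    using Metric_space_modular_norm lp_sum_definite by (simp add: lp_space_def lp_norm_def modular_norm_def)
qed

lemma Metric_space_lpqr:
  assumes "1 \<le> p" "1 \<le> r"
  shows "Metric_space (lpqr_space p q r) (\<lambda>x y. lpqr_norm p q r (\<lambda>k. x k - y k))"
proof -
  interpret convex_modular "lpqr_sum p q r" r using assms by (rule convex_modular_lpqr_sum)
  have "x = (\<lambda>k. 0)" if "lpqr_sum p q r x = 0" for x
    using lp_sum_le_lpqr_sum[OF assms(1), of r x q] that by (intro lp_sum_definite[of r]) simp
  thus ?thesis
    using Metric_space_modular_norm by (simp add: lpqr_space_def lpqr_norm_def modular_norm_def)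
qed

section \<open>The inclusions and their continuity\<close>

lemma summable_on_dyadic_weights:
  fixes e :: real
  assumes "0 < e"
  shows "(\<lambda>j::nat. (2 ^ j) powr - e) summable_on UNIV"
proof -
  have "(2 ^ j) powr - e = (2 powr - e :: real) ^ j" for j
    by (simp add: powr_realpow[symmetric] powr_powr mult.commute)
  moreover have "2 powr - e < (1::real)" using assms by (simp add: powr_less_one)
  ultimately show ?thesis
    by (simp add: summable_on_UNIV_nonneg_real_iff summable_geometric)
qed

text \<open>
  The inclusion of \<open>\<ell>\<^sup>1\<close> in \<open>\<ell>\<^sup>p\<close> inside each block, and then that of \<open>\<ell>\<^sup>1\<close> in \<open>\<ell>\<^sup>r\<close>
  for the sequence of block sums, bound one level by the \<open>\<ell>\<^sup>1\<close>-norm, uniformly in \<open>j\<close>.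
\<close>

lemma sum_block_powr_le:
  fixes x :: "int \<Rightarrow> real"
  assumes "1 \<le> p" "1 \<le> r" and x: "(\<lambda>k. \<bar>x k\<bar>) summable_on UNIV" and "finite K"
  shows "(\<Sum>k\<in>K. (\<Sum>l\<in>dyadic_interval j k. \<bar>x l\<bar> powr p) powr (r / p)) \<le> (\<Sum>\<^sub>\<infinity>k. \<bar>x k\<bar>) powr r"
proof -
  define T where "T k = (\<Sum>l\<in>dyadic_interval j k. \<bar>x l\<bar>)" for k
  have T: "0 \<le> T k" for k unfolding T_def by (intro sum_nonneg) simp
  have "(\<Sum>l\<in>dyadic_interval j k. \<bar>x l\<bar> powr p) powr (r / p) \<le> T k powr r" for k
  proof -
    have "(\<Sum>l\<in>dyadic_interval j k. \<bar>x l\<bar> powr p) \<le> T k powr p"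
      unfolding T_def using assms finite_dyadic_interval by (intro sum_powr_le_powr_sum) auto
    hence "(\<Sum>l\<in>dyadic_interval j k. \<bar>x l\<bar> powr p) powr (r / p) \<le> (T k powr p) powr (r / p)"
      using assms by (intro powr_mono2) (auto simp: sum_nonneg)
    thus ?thesis using assms by (simp add: powr_powr)
  qed
  hence "(\<Sum>k\<in>K. (\<Sum>l\<in>dyadic_interval j k. \<bar>x l\<bar> powr p) powr (r / p)) \<le> (\<Sum>k\<in>K. T k powr r)"
    by (intro sum_mono)
  also have "\<dots> \<le> (\<Sum>k\<in>K. T k) powr r"
    using assms T by (intro sum_powr_le_powr_sum) auto
  also have "(\<Sum>k\<in>K. T k) = (\<Sum>l\<in>(\<Union>k\<in>K. dyadic_interval j k). \<bar>x l\<bar>)"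
    unfolding T_def using assms
    by (intro sum.UNION_disjoint[symmetric]) (auto simp: finite_dyadic_interval mem_dyadic_interval_iff)
  also have "\<dots> powr r \<le> (\<Sum>\<^sub>\<infinity>k. \<bar>x k\<bar>) powr r"
    using assms by (intro powr_mono2 finite_sum_le_infsum)
      (auto simp: sum_nonneg finite_dyadic_interval)
  finally show ?thesis .
qed

text \<open>
  The total weight of all levels, a convergent geometric series for \<open>1 \<le> p < q\<close> and \<open>r \<ge> 1\<close>.
\<close>

definition scale_constant :: "real \<Rightarrow> real \<Rightarrow> real \<Rightarrow> real" where
  "scale_constant p q r = (\<Sum>\<^sub>\<infinity>j::nat. (2 ^ j) powr (r * (1 / q - 1 / p)))"

text \<open>
  Each level without its weight is at most \<open>lp_norm 1 x powr r\<close>, so only the weights are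
  left to be summed.
\<close>

lemma lpqr_sum_le_lp_norm:
  assumes "1 \<le> p" "p < q" "1 \<le> r" and x: "x \<in> lp_space 1"
  shows "lpqr_sum p q r x \<le> ennreal (scale_constant p q r * lp_norm 1 x powr r)"
proof -
  define w where "w j = (2 ^ j) powr (r * (1 / q - 1 / p))" for j :: nat
  have sx: "(\<lambda>k. \<bar>x k\<bar>) summable_on UNIV"
    using x infsum_ennreal_finite_iff[of "\<lambda>k. \<bar>x k\<bar>" UNIV] by (simp add: lp_space_def lp_sum_def)
  have norm: "lp_norm 1 x = (\<Sum>\<^sub>\<infinity>k. \<bar>x k\<bar>)"
    using sx by (simp add: lp_norm_def lp_sum_def infsum_ennreal_of_summable_on infsum_nonneg)
  have w_nonneg: "0 \<le> w j" for j by (simp add: w_def)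
  have w: "w summable_on UNIV"
    using summable_on_dyadic_weights[of "r * (1 / p - 1 / q)"] assms
    by (simp add: w_def[abs_def] frac_less2 algebra_simps)
  have "(\<Sum>\<^sub>\<infinity>k. ennreal (w j * (\<Sum>l\<in>dyadic_interval j k. \<bar>x l\<bar> powr p) powr (r / p)))
      \<le> ennreal (w j) * ennreal (lp_norm 1 x powr r)" for j
  proof -
    have "(\<Sum>\<^sub>\<infinity>k. ennreal ((\<Sum>l\<in>dyadic_interval j k. \<bar>x l\<bar> powr p) powr (r / p)))
        \<le> ennreal (lp_norm 1 x powr r)"
      unfolding norm
      by (rule infsum_le_finite_sums)
        (use sum_block_powr_le[OF assms(1,3) sx] in \<open>auto simp: nonneg_summable_on_complete sum_ennreal ennreal_leI\<close>)
    thus ?thesis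
      by (simp add: w_def ennreal_mult infsum_cmult_ennreal mult_left_mono)
  qed
  hence "lpqr_sum p q r x \<le> (\<Sum>\<^sub>\<infinity>j. ennreal (lp_norm 1 x powr r) * ennreal (w j))"
    unfolding lpqr_sum_def w_def by (intro infsum_mono_ennreal) (simp add: mult.commute)
  also have "\<dots> = ennreal (lp_norm 1 x powr r) * ennreal (\<Sum>\<^sub>\<infinity>j. w j)"
    using infsum_ennreal_of_summable_on[OF w] w_nonneg by (simp add: infsum_cmult_ennreal)
  also have "\<dots> = ennreal (scale_constant p q r * lp_norm 1 x powr r)"
    by (simp add: scale_constant_def w_def ennreal_mult infsum_nonneg mult.commute)
  finally show ?thesis .
qed

lemma lpqr_norm_le_lp_norm:
  assumes "1 \<le> p" "p < q" "1 \<le> r" and x: "x \<in> lp_space 1"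
  shows "lpqr_norm p q r x \<le> scale_constant p q r powr (1 / r) * lp_norm 1 x"
proof -
  have C: "0 \<le> scale_constant p q r" by (simp add: scale_constant_def infsum_nonneg)
  have "enn2real (lpqr_sum p q r x) \<le> scale_constant p q r * lp_norm 1 x powr r"
    using lpqr_sum_le_lp_norm[OF assms] C by (simp add: enn2real_leI)
  hence "lpqr_norm p q r x \<le> (scale_constant p q r * lp_norm 1 x powr r) powr (1 / r)"
    unfolding lpqr_norm_def using assms by (intro powr_mono2) auto
  thus ?thesis
    using assms C by (simp add: powr_mult powr_powr lp_norm_def)
qed

lemma lp_norm_le_lpqr_norm:
  assumes "1 \<le> p" "1 \<le> r" "x \<in> lpqr_space p q r"
  shows "lp_norm r x \<le> lpqr_norm p q r x"
  unfolding lp_norm_def lpqr_norm_def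
  using assms lp_sum_le_lpqr_sum[OF assms(1), of r x q]
  by (intro powr_mono2 enn2real_mono) (auto simp: lpqr_space_def)

lemma lp_space_1_subset_lpqr_space:
  assumes "1 \<le> p" "p < q" "1 \<le> r"
  shows "lp_space 1 \<subseteq> lpqr_space p q r"
proof
  fix x assume "x \<in> lp_space 1"
  from lpqr_sum_le_lp_norm[OF assms this] show "x \<in> lpqr_space p q r"
    by (auto simp: lpqr_space_def intro: le_less_trans)
qed

lemma lpqr_space_subset_lp_space:
  assumes "1 \<le> p"
  shows "lpqr_space p q r \<subseteq> lp_space r"
  using lp_sum_le_lpqr_sum[OF assms] by (auto simp: lpqr_space_def lp_space_def intro: le_less_trans)

lemma continuous_map_lp_1_lpqr:
  assumes "1 \<le> p" "p < q" "1 \<le> r"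
  shows "continuous_map (lp_topology 1) (lpqr_topology p q r) (\<lambda>x. x)"
proof (rule continuous_map_norm_topology)
  fix x y assume "x \<in> lp_space 1" "y \<in> lp_space 1"
  hence "(\<lambda>k. x k - y k) \<in> lp_space 1"
    using convex_modular.diff_finite[OF convex_modular_lp_sum[of 1]] by (simp add: lp_space_def)
  thus "lpqr_norm p q r (\<lambda>k. x k - y k)
      \<le> scale_constant p q r powr (1 / r) * lp_norm 1 (\<lambda>k. x k - y k)"
    by (rule lpqr_norm_le_lp_norm[OF assms])
qed (use assms Metric_space_lp Metric_space_lpqr lp_space_1_subset_lpqr_space in auto)

lemma continuous_map_lpqr_lp:
  assumes "1 \<le> p" "1 \<le> r"
  shows "continuous_map (lpqr_topology p q r) (lp_topology r) (\<lambda>x. x)"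
proof (rule continuous_map_norm_topology)
  fix x y assume "x \<in> lpqr_space p q r" "y \<in> lpqr_space p q r"
  hence "(\<lambda>k. x k - y k) \<in> lpqr_space p q r"
    using convex_modular.diff_finite[OF convex_modular_lpqr_sum[OF assms]]
    by (simp add: lpqr_space_def)
  thus "lp_norm r (\<lambda>k. x k - y k) \<le> 1 * lpqr_norm p q r (\<lambda>k. x k - y k)"
    using lp_norm_le_lpqr_norm[OF assms] by simp
qed (use assms Metric_space_lp Metric_space_lpqr lpqr_space_subset_lp_space in auto)

section \<open>Power sequences separating the spaces\<close>

text \<open>
  Two members of this family separate the spaces. The decay \<open>1 / k\<close> just fails to be in \<open>\<ell>\<^sup>1\<close>,
  and \<open>k powr - (1 / q)\<close> is the critical decay for \<open>\<ell>\<^sup>p\<^sub>q\<^sub>,\<^sub>r\<close>, where the block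
  \<open>[2^j, 2^(j+1))\<close> contributes equally on all levels up to a constant factor.
\<close>

definition power_seq :: "real \<Rightarrow> int \<Rightarrow> real" where
  "power_seq s k = (if 1 \<le> k then real_of_int k powr - s else 0)"

lemma power_seq_nonneg: "0 \<le> power_seq s k"
  by (simp add: power_seq_def)

lemma power_seq_powr: "\<bar>power_seq s k\<bar> powr t = power_seq (s * t) k"
  by (simp add: power_seq_def powr_powr)

lemma power_seq_summable_on_iff: "power_seq s summable_on UNIV \<longleftrightarrow> 1 < s"
proof -
  have "power_seq s summable_on UNIV \<longleftrightarrow> power_seq s summable_on {1..}"
    by (rule summable_on_cong_neutral) (auto simp: power_seq_def)
  also have "\<dots> \<longleftrightarrow> (\<lambda>n. power_seq s (int (Suc n))) summable_on UNIV"
  proof (rule summable_on_reindex_bij_betw[symmetric])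
    show "bij_betw (\<lambda>n. int (Suc n)) UNIV {1..}"
      by (rule bij_betw_byWitness[where f' = "\<lambda>k. nat (k - 1)"]) auto
  qed
  also have "\<dots> \<longleftrightarrow> summable (\<lambda>n. power_seq s (int (Suc n)))"
    by (rule summable_on_UNIV_nonneg_real_iff) (rule power_seq_nonneg)
  also have "\<dots> \<longleftrightarrow> summable (\<lambda>n. real (Suc n) powr - s)"
    by (simp add: power_seq_def)
  also have "\<dots> \<longleftrightarrow> 1 < s"
    using summable_Suc_iff[of "\<lambda>n. real n powr - s"] summable_real_powr_iff[of "- s"] by simp
  finally show ?thesis .
qed

lemma power_seq_mem_lp_space_iff: "power_seq s \<in> lp_space t \<longleftrightarrow> 1 < s * t"
  using infsum_ennreal_finite_iff[of "power_seq (s * t)" UNIV, OF power_seq_nonneg]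
  by (simp add: lp_space_def lp_sum_def power_seq_powr power_seq_summable_on_iff)

lemma power_seq_anti:
  assumes "1 \<le> m" "m \<le> k" "0 \<le> s"
  shows "power_seq s k \<le> power_seq s m"
  using assms by (simp add: power_seq_def powr_mono2')

text \<open>
  The first entry of a block is its largest.
\<close>

lemma sum_power_seq_block_le:
  assumes "1 \<le> k" "0 \<le> s"
  shows "(\<Sum>l\<in>dyadic_interval j k. power_seq s l) \<le> 2 ^ j * (2 ^ j) powr - s * power_seq s k"
proof -
  have one_le: "1 \<le> 2 ^ j * k"
    using assms mult_mono[of 1 "2 ^ j" 1 k] by simp
  have "(\<Sum>l\<in>dyadic_interval j k. power_seq s l)
      \<le> of_nat (card (dyadic_interval j k)) * power_seq s (2 ^ j * k)"
    using one_le assms by (intro sum_bounded_above power_seq_anti) (auto simp: dyadic_interval_def)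
  also have "\<dots> = 2 ^ j * (2 ^ j) powr - s * power_seq s k"
    using assms one_le by (simp add: card_dyadic_interval power_seq_def powr_mult)
  finally show ?thesis .
qed

text \<open>
  The interval \<open>[0, 2^j)\<close> is \<open>{0}\<close> together with the \<open>j\<close> intervals \<open>[2^i, 2^(i+1))\<close>, \<open>i < j\<close>, each of
  which contributes at most 1. In the borderline case \<open>s = 1\<close> this is the logarithmic growth
  of the harmonic sums.
\<close>

lemma sum_power_seq_first_block_le:
  assumes "1 \<le> s"
  shows "(\<Sum>l\<in>dyadic_interval j 0. power_seq s l) \<le> real j"
proof (induction j)
  case 0
  show ?case by (simp add: dyadic_interval_0 power_seq_def)
next
  case (Suc j)
  have "dyadic_interval (Suc j) 0 = dyadic_interval j 0 \<union> dyadic_interval j 1"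
    by (auto simp: dyadic_interval_def)
  hence "(\<Sum>l\<in>dyadic_interval (Suc j) 0. power_seq s l)
      = (\<Sum>l\<in>dyadic_interval j 0. power_seq s l) + (\<Sum>l\<in>dyadic_interval j 1. power_seq s l)"
    by (simp only:, intro sum.union_disjoint)
      (auto simp: finite_dyadic_interval mem_dyadic_interval_iff)
  moreover have "(\<Sum>l\<in>dyadic_interval j 1. power_seq s l) \<le> 1"
  proof -
    have "(\<Sum>l\<in>dyadic_interval j 1. power_seq s l) \<le> 2 ^ j * (2 ^ j) powr - s"
      using sum_power_seq_block_le[of 1 s j] assms by (simp add: power_seq_def)
    also have "\<dots> = (2 ^ j) powr (1 - s)"
      by (simp add: powr_diff powr_minus divide_inverse)
    also have "\<dots> \<le> (2 ^ j) powr 0"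
      using assms by (intro powr_mono) auto
    finally show ?thesis by simp
  qed
  ultimately show ?case using Suc by simp
qed

lemma summable_on_powr_mult_dyadic_weights:
  fixes a e :: real
  assumes "0 < e"
  shows "(\<lambda>j::nat. (2 ^ j) powr - e * real j powr a) summable_on UNIV"
proof -
  have eq: "(2 ^ j) powr - e = (2 powr (- e * real j) :: real)" for j :: nat
    by (simp add: powr_realpow[symmetric] powr_powr mult.commute)
  have "summable (\<lambda>j::nat. 2 powr (- e * real j) * real j powr a)"
  proof (rule summable_comparison_test_bigo)
    show "summable (\<lambda>j::nat. norm (real j powr - 2))"
      using summable_real_powr_iff[of "- 2"] by simp
    show "(\<lambda>j::nat. 2 powr (- e * real j) * real j powr a) \<in> O(\<lambda>j. real j powr - 2)"
      using assms by real_asymp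
  qed
  thus ?thesis by (simp add: summable_on_UNIV_nonneg_real_iff eq)
qed

text \<open>
  On level \<open>j\<close> the block at 0 is at most polynomial in \<open>j\<close> and its weight decays exponentially.
  For \<open>k \<ge> 1\<close> the entries are at most \<open>1 / (2^j * k)\<close>, so the weighted term is at most
  \<open>2 powr (- j * r * (1 - 1 / q)) * k powr - r\<close>. This is summable over \<open>k\<close> because \<open>r > 1\<close>, and
  over \<open>j\<close> because \<open>q > 1\<close>.
\<close>

lemma reciprocal_mem_lpqr_space:
  assumes "1 \<le> p" "p < q" "1 < r"
  shows "power_seq 1 \<in> lpqr_space p q r"
proof -
  define w where "w j = (2 ^ j) powr (r * (1 / q - 1 / p))" for j :: nat
  \<comment> \<open>The \<open>p\<close>-th powers of the entries \<open>1 / l\<close> form the power sequence of exponent \<open>p\<close>.\<close>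
  define S where "S j k = (\<Sum>l\<in>dyadic_interval j k. power_seq p l)" for j k
  define A where "A j = w j * real j powr (r / p)" for j
  define B where "B j = (2 ^ j) powr - (r * (1 - 1 / q))" for j :: nat
  have S_nonneg: "0 \<le> S j k" for j k
    unfolding S_def by (intro sum_nonneg power_seq_nonneg)
  have bound: "w j * S j k powr (r / p) \<le> A j * (if k = 0 then 1 else 0) + B j * power_seq r k" for j k
  proof -
    consider "k < 0" | "k = 0" | "1 \<le> k" by linarith
    thus ?thesis
    proof cases
      case 1
      have "S j k = 0"
        unfolding S_def
      proof (rule sum.neutral, rule ballI)
        fix l assume "l \<in> dyadic_interval j k"
        hence "l div 2 ^ j < 0" using 1 by (simp add: mem_dyadic_interval_iff)
        hence "l < 0" by (simp add: pos_imp_zdiv_neg_iff)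
        thus "power_seq p l = 0" by (simp add: power_seq_def)
      qed
      thus ?thesis using 1 by (simp add: power_seq_def)
    next
      case 2
      have "S j 0 powr (r / p) \<le> real j powr (r / p)"
        unfolding S_def using assms sum_power_seq_first_block_le[of p j]
        by (intro powr_mono2 sum_nonneg power_seq_nonneg) auto
      thus ?thesis using 2 by (simp add: A_def w_def power_seq_def mult_left_mono)
    next
      case 3
      have "S j k powr (r / p) \<le> (2 ^ j * (2 ^ j) powr - p * power_seq p k) powr (r / p)"
        using assms 3 sum_power_seq_block_le[of k p j] S_nonneg[of j k]
        by (intro powr_mono2) (auto simp: S_def)
      also have "\<dots> = (2 ^ j) powr (r / p - r) * power_seq r k"
      proof -
        have "2 ^ j * (2 ^ j) powr - p = (2 ^ j) powr (1 - p)"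
          by (simp add: powr_diff powr_minus divide_inverse)
        moreover have "(1 - p) * (r / p) = r / p - r"
          using assms by (simp add: field_simps)
        ultimately show ?thesis
          using power_seq_powr[of p k "r / p"] assms power_seq_nonneg[of p k]
          by (simp add: powr_mult powr_powr)
      qed
      finally have "w j * S j k powr (r / p)
          \<le> w j * ((2 ^ j) powr (r / p - r) * power_seq r k)"
        by (intro mult_left_mono) (simp_all add: w_def)
      also have "\<dots> = B j * power_seq r k"
        unfolding w_def B_def mult.assoc[symmetric] powr_add[symmetric]
        by (simp add: algebra_simps)
      finally show ?thesis using 3 by simp
    qed
  qed
  have "0 < r * (1 / p - 1 / q)" "0 < r * (1 - 1 / q)"
    using assms by (auto simp: frac_less2)
  hence AB: "A summable_on UNIV" "B summable_on UNIV"
    using summable_on_powr_mult_dyadic_weights[of "r * (1 / p - 1 / q)" "r / p"]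
      summable_on_dyadic_weights[of "r * (1 - 1 / q)"]
    by (simp_all add: A_def[abs_def] B_def[abs_def] w_def algebra_simps)
  define Z where "Z = (\<Sum>\<^sub>\<infinity>k. power_seq r k)"
  have Z_nonneg: "0 \<le> Z" unfolding Z_def by (intro infsum_nonneg power_seq_nonneg)
  have "(\<Sum>\<^sub>\<infinity>k. ennreal (w j * S j k powr (r / p))) \<le> ennreal (A j + B j * Z)" for j
  proof -
    have A_sum: "((\<lambda>k::int. A j * (if k = 0 then 1 else 0)) has_sum A j) UNIV"
      using has_sum_finite_neutralI[of "{0}" UNIV "\<lambda>k::int. A j * (if k = 0 then 1 else 0)" "A j"]
      by simp
    have "power_seq r summable_on UNIV" using assms by (simp add: power_seq_summable_on_iff)
    hence B_sum: "((\<lambda>k. B j * power_seq r k) has_sum (B j * Z)) UNIV"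
      unfolding Z_def by (intro has_sum_cmult_right has_sum_infsum)
    have "(\<Sum>\<^sub>\<infinity>k. ennreal (w j * S j k powr (r / p)))
        \<le> (\<Sum>\<^sub>\<infinity>k. ennreal (A j * (if k = 0 then 1 else 0) + B j * power_seq r k))"
      by (intro infsum_mono_ennreal ennreal_leI bound)
    also have "\<dots> = ennreal (\<Sum>\<^sub>\<infinity>k. A j * (if k = 0 then 1 else 0) + B j * power_seq r k)"
      using has_sum_add[OF A_sum B_sum] power_seq_nonneg
      by (intro infsum_ennreal_of_summable_on)
        (auto simp: summable_on_def A_def B_def w_def intro!: add_nonneg_nonneg)
    also have "(\<Sum>\<^sub>\<infinity>k. A j * (if k = 0 then 1 else 0) + B j * power_seq r k) = A j + B j * Z"
      by (rule infsumI[OF has_sum_add[OF A_sum B_sum]])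
    finally show ?thesis .
  qed
  hence "lpqr_sum p q r (power_seq 1) \<le> (\<Sum>\<^sub>\<infinity>j. ennreal (A j + B j * Z))"
    unfolding lpqr_sum_def power_seq_powr w_def S_def by (intro infsum_mono_ennreal) simp
  also have "\<dots> < \<infinity>"
  proof -
    have "0 \<le> A j + B j * Z" for j using Z_nonneg by (simp add: A_def B_def w_def)
    moreover have "(\<lambda>j. A j + B j * Z) summable_on UNIV"
      using AB by (intro summable_on_add summable_on_cmult_left)
    ultimately show ?thesis by (simp only: infsum_ennreal_finite_iff)
  qed
  finally show ?thesis by (simp add: lpqr_space_def)
qed

text \<open>
  The block \<open>[2^j, 2^(j+1))\<close> has \<open>2^j\<close> entries, each at least \<open>(2^(j+1)) powr - (1 / q)\<close>. With the
  weight of level \<open>j\<close> all powers of \<open>2^j\<close> cancel, and every level contributes at least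
  the constant \<open>2 powr - (r / q)\<close>.
\<close>

lemma critical_power_notin_lpqr_space:
  assumes "1 \<le> p" "p < q" "1 \<le> r"
  shows "power_seq (1 / q) \<notin> lpqr_space p q r"
proof -
  define T where "T j k = (2 ^ j) powr (r * (1 / q - 1 / p))
    * (\<Sum>l\<in>dyadic_interval j k. \<bar>power_seq (1 / q) l\<bar> powr p) powr (r / p)" for j :: nat and k
  have lower: "2 powr - (r / q) \<le> T j 1" for j
  proof -
    have "2 ^ j * (2 ^ Suc j) powr - (p / q) \<le> (\<Sum>l\<in>dyadic_interval j 1. \<bar>power_seq (1 / q) l\<bar> powr p)"
    proof -
      have "of_nat (card (dyadic_interval j 1)) * (2 ^ Suc j) powr - (p / q)
          \<le> (\<Sum>l\<in>dyadic_interval j 1. \<bar>power_seq (1 / q) l\<bar> powr p)"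
      proof (rule sum_bounded_below)
        fix l assume l: "l \<in> dyadic_interval j 1"
        have "1 \<le> (2 :: int) ^ j" by simp
        with l have "1 \<le> l" "l \<le> 2 ^ Suc j" by (auto simp: dyadic_interval_def)
        hence "power_seq (p / q) (2 ^ Suc j) \<le> power_seq (p / q) l"
          using assms by (intro power_seq_anti) auto
        moreover have "(1::int) \<le> 2 ^ Suc j" by (rule one_le_power) simp
        ultimately show "(2 ^ Suc j) powr - (p / q) \<le> \<bar>power_seq (1 / q) l\<bar> powr p"
          by (simp add: power_seq_powr power_seq_def[of _ "2 ^ Suc j"] del: power_Suc)
      qed
      thus ?thesis by (simp add: card_dyadic_interval)
    qed
    hence "(2 ^ j) powr (r * (1 / q - 1 / p)) * (2 ^ j * (2 ^ Suc j) powr - (p / q)) powr (r / p)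
        \<le> T j 1"
      unfolding T_def using assms by (intro mult_left_mono powr_mono2) auto
    moreover have "(2 ^ j) powr (r * (1 / q - 1 / p)) * (2 ^ j * (2 ^ Suc j) powr - (p / q)) powr (r / p)
        = 2 powr - (r / q)"
    proof -
      have "(2 ^ j * (2 ^ Suc j) powr - (p / q)) powr (r / p)
          = (2 ^ j) powr (r / p) * (2 powr - (r / q) * (2 ^ j) powr - (r / q))"
        using assms by (simp add: powr_mult powr_powr)
      moreover have "(2 ^ j) powr (r * (1 / q - 1 / p)) * (2 ^ j) powr (r / p) * (2 ^ j) powr - (r / q)
          = (2 ^ j) powr (0 :: real)"
        unfolding powr_add[symmetric] by (simp add: algebra_simps)
      ultimately show ?thesis by (simp add: mult_ac)
    qed
    ultimately show ?thesis by simp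
  qed
  have "ennreal (2 powr - (r / q)) \<le> (\<Sum>\<^sub>\<infinity>k. ennreal (T j k))" for j
    using ennreal_leI[OF lower[of j]] term_le_infsum_ennreal[of 1 UNIV "\<lambda>k. ennreal (T j k)"]
    by (rule order_trans) simp
  hence "(\<Sum>\<^sub>\<infinity>j. \<Sum>\<^sub>\<infinity>k. ennreal (T j k)) = \<infinity>"
    by (rule infsum_superconst_infinite_ennreal) auto
  thus ?thesis by (simp add: lpqr_space_def lpqr_sum_def T_def)
qed

theorem proposition2p2:
  fixes p q r :: real
  assumes "1 \<le> p" and "p < q" and "1 \<le> r"
  shows "(1 < r \<longrightarrow>
            lp_space 1 \<subseteq> lpqr_space p q r \<and>
            lpqr_space p q r \<subseteq> lp_space r \<and>
            continuous_map (lp_topology 1) (lpqr_topology p q r) (\<lambda>x. x) \<and>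
            continuous_map (lpqr_topology p q r) (lp_topology r) (\<lambda>x. x) \<and>
            lp_space 1 \<noteq> lpqr_space p q r) \<and>
         (q < r \<longrightarrow>
            lp_space 1 \<subset> lpqr_space p q r \<and>
            lpqr_space p q r \<subset> lp_space r) \<and>
         (r = 1 \<longrightarrow> lpqr_space p q r = lp_space 1)"
proof -
  note incl = lp_space_1_subset_lpqr_space[OF assms] lpqr_space_subset_lp_space[OF assms(1), of q r]
  have neq: "lp_space 1 \<noteq> lpqr_space p q r" if "1 < r"
    using reciprocal_mem_lpqr_space[OF assms(1,2) that] power_seq_mem_lp_space_iff[of 1 1] by auto
  have "lpqr_space p q r \<noteq> lp_space r" if "q < r"
  proof -
    have "power_seq (1 / q) \<in> lp_space r"
      using assms that by (simp add: power_seq_mem_lp_space_iff)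
    thus ?thesis using critical_power_notin_lpqr_space[OF assms] by blast
  qed
  thus ?thesis
    using incl neq continuous_map_lp_1_lpqr[OF assms] continuous_map_lpqr_lp[OF assms(1,3), of q] assms
    by (auto simp: psubset_eq)
qed

end
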